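(* There exist no construction data, as defined in the context, with parameters $(\lambda,\mu)=(2,1)$; that is, the construction yields no graph $\overline{\Gamma}$ for $(\lambda,\mu)=(2,1)$.
   Context: Graphs are finite, simple and undirected. For $k\ge 1$, a $k$-regular graph on $v\ge 2$ vertices is edge-regular with parameters $(v,k,\lambda)$ if any two adjacent vertices have exactly $\lambda$ common neighbours. Construction data with parameters $(\lambda,\mu)$, where $\lambda,\mu$ are positive integers with $\mu\mid(\lambda+2)$. Put $n:=\mu\lambda(\lambda+2)$, $k:=\lambda(\mu+1)$, $\nu:=(\lambda+2)/\mu$. The data consist of the following. - Three vertex-disjoint edge-regular graphs $\Gamma_i=(V_i,E_i)$, $i\in\{1,2,3\}$, each with parameters $(n,k,\lambda)$. - For each $i$, a partition $\Omega_i$ of $V_i$ into $\nu$ sets of size $\mu^2\lambda$, and two partitions $\mathcal{P}_i,\mathcal{P}_i'$ of $V_i$ into $\mu\nu$ independent sets of $\Gamma_i$ of size $\mu\lambda$, such that every element of $\Omega_i$ is the union of $\mu$ elements of $\mathcal{P}_i$ and also the union of $\mu$ elements of $\mathcal{P}_i'$, and such that whenever $\omega\in\Omega_i$, $P\in\mathcal{P}_i$, $P'\in\mathcal{P}_i'$ satisfy $P,P'\subseteq\omega$, then $|P\cap P'|=\lambda$. - Three admissible bijections $\varphi_{12}:\mathcal{P}_1\to\mathcal{P}_2'$, $\varphi_{23}:\mathcal{P}_2\to\mathcal{P}_3'$, $\varphi_{31}:\mathcal{P}_3\to\mathcal{P}_1'$. Here a bijection $\varphi:\mathcal{P}_i\to\mathcal{P}_j'$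 ($i\ne j$) is admissible if for every $\omega=P_1\cup\dots\cup P_\mu\in\Omega_i$ with $P_1,\dots,P_\mu\in\mathcal{P}_i$, the set $\omega^\varphi:=P_1^\varphi\cup\dots\cup P_\mu^\varphi$ belongs to $\Omega_j$; so $\varphi$ induces a map $\Omega_i\to\Omega_j$. It is required that the composition of the induced maps $\Omega_1\to\Omega_2\to\Omega_3\to\Omega_1$ (of $\varphi_{12}$, then $\varphi_{23}$, then $\varphi_{31}$) is the identity on $\Omega_1$. The graph $\overline{\Gamma}$ has vertex set $V_1\cup V_2\cup V_3$. Two vertices of the same $V_i$ are adjacent in $\overline{\Gamma}$ iff they are adjacent in $\Gamma_i$. For $(i,j)\in\{(1,2),(2,3),(3,1)\}$, a vertex $v\in V_i$ and a vertex $w\in V_j$ are adjacent iff $w\in\varphi_{ij}(P)$, where $P$ is the unique element of $\mathcal{P}_i$ containing $v$. *)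

theory Defs
  imports
    "Graph_Theory.Pair_Digraph"
    "HOL-Library.Disjoint_Sets"
begin

text \<open>
  Finite simple undirected graphs are the \<^locale>\<open>pair_graph\<close>s of the Graph Theory library:
  finite loopless digraphs whose arc set is a symmetric relation on the vertices.
\<close>

definition common_neighbours :: "'a pair_pre_digraph \<Rightarrow> 'a \<Rightarrow> 'a \<Rightarrow> 'a set" where
  "common_neighbours G u v = {w \<in> pverts G. (u, w) \<in> parcs G \<and> (v, w) \<in> parcs G}"

definition regular_graph :: "nat \<Rightarrow> 'a pair_pre_digraph \<Rightarrow> bool" where
  "regular_graph k G \<longleftrightarrow> pair_graph G \<and> (\<forall>v \<in> pverts G. out_degree (with_proj G) v = k)"

definition edge_regular :: "nat \<Rightarrow> nat \<Rightarrow> nat \<Rightarrow> 'a pair_pre_digraph \<Rightarrow> bool" where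
  "edge_regular v k l G \<longleftrightarrow>
     k \<ge> 1 \<and> v \<ge> 2 \<and> regular_graph k G \<and> card (pverts G) = v \<and>
     (\<forall>(x, y) \<in> parcs G. card (common_neighbours G x y) = l)"

definition independent_in :: "'a pair_pre_digraph \<Rightarrow> 'a set \<Rightarrow> bool" where
  "independent_in G S \<longleftrightarrow> S \<subseteq> pverts G \<and> (\<forall>x \<in> S. \<forall>y \<in> S. (x, y) \<notin> parcs G)"

definition partition_into :: "'a set \<Rightarrow> nat \<Rightarrow> nat \<Rightarrow> 'a set set \<Rightarrow> bool" where
  "partition_into A m s P \<longleftrightarrow> partition_on A P \<and> card P = m \<and> (\<forall>X \<in> P. card X = s)"

definition union_of :: "nat \<Rightarrow> 'a set set \<Rightarrow> 'a set \<Rightarrow> bool" where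
  "union_of m P w \<longleftrightarrow> (\<exists>Q \<subseteq> P. card Q = m \<and> w = \<Union>Q)"

text \<open>
  The image of \<open>w\<close> under \<open>f\<close>. If \<open>w\<close> is a union of members of a partition \<open>P\<close>, then the
  members of \<open>P\<close> contained in \<open>w\<close> are exactly those whose union it is.
\<close>

definition induced_map :: "'a set set \<Rightarrow> ('a set \<Rightarrow> 'a set) \<Rightarrow> 'a set \<Rightarrow> 'a set" where
  "induced_map P f w = \<Union>(f ` {X \<in> P. X \<subseteq> w})"

definition admissible ::
  "'a set set \<Rightarrow> 'a set set \<Rightarrow> 'a set set \<Rightarrow> 'a set set \<Rightarrow> ('a set \<Rightarrow> 'a set) \<Rightarrow> bool" where
  "admissible Om P Om' P' f \<longleftrightarrow> bij_betw f P P' \<and> (\<forall>w \<in> Om. induced_map P f w \<in> Om')"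

text \<open>
  Only the values of the fields at indices \<open>i \<in> {1, 2, 3}\<close>, and of \<open>phi i j\<close> at
  \<open>(i, j) \<in> {(1, 2), (2, 3), (3, 1)}\<close>, are meaningful. The fields \<open>PP\<close> and \<open>PP'\<close> are the two
  families of partitions into independent sets.
\<close>

record 'a data =
  Gam :: "nat \<Rightarrow> 'a pair_pre_digraph"
  Om :: "nat \<Rightarrow> 'a set set"
  PP :: "nat \<Rightarrow> 'a set set"
  PP' :: "nat \<Rightarrow> 'a set set"
  phi :: "nat \<Rightarrow> nat \<Rightarrow> 'a set \<Rightarrow> 'a set"

definition index_pairs :: "(nat \<times> nat) set" where
  "index_pairs = {(1, 2), (2, 3), (3, 1)}"

definition construction_data :: "nat \<Rightarrow> nat \<Rightarrow> 'a data \<Rightarrow> bool" where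
  "construction_data l m D \<longleftrightarrow>
     l > 0 \<and> m > 0 \<and> m dvd l + 2 \<and>
     (let n = m * l * (l + 2); k = l * (m + 1); nu = (l + 2) div m in
       (\<forall>i \<in> {1, 2, 3}. edge_regular n k l (Gam D i)) \<and>
       disjoint_family_on (\<lambda>i. pverts (Gam D i)) {1, 2, 3} \<and>
       (\<forall>i \<in> {1, 2, 3}.
          partition_into (pverts (Gam D i)) nu (m\<^sup>2 * l) (Om D i) \<and>
          partition_into (pverts (Gam D i)) (m * nu) (m * l) (PP D i) \<and>
          partition_into (pverts (Gam D i)) (m * nu) (m * l) (PP' D i) \<and>
          (\<forall>X \<in> PP D i \<union> PP' D i. independent_in (Gam D i) X) \<and>
          (\<forall>w \<in> Om D i. union_of m (PP D i) w \<and> union_of m (PP' D i) w) \<and>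
          (\<forall>w \<in> Om D i. \<forall>P \<in> PP D i. \<forall>P' \<in> PP' D i.
             P \<subseteq> w \<and> P' \<subseteq> w \<longrightarrow> card (P \<inter> P') = l)) \<and>
       (\<forall>(i, j) \<in> index_pairs. admissible (Om D i) (PP D i) (Om D j) (PP' D j) (phi D i j)) \<and>
       (\<forall>w \<in> Om D 1.
          induced_map (PP D 3) (phi D 3 1)
            (induced_map (PP D 2) (phi D 2 3)
              (induced_map (PP D 1) (phi D 1 2) w)) = w))"

definition cross_arcs :: "'a data \<Rightarrow> nat \<Rightarrow> nat \<Rightarrow> ('a \<times> 'a) set" where
  "cross_arcs D i j =
     {(v, w). v \<in> pverts (Gam D i) \<and> w \<in> pverts (Gam D j) \<and>
              w \<in> phi D i j (THE P. P \<in> PP D i \<and> v \<in> P)}"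

definition Gamma_bar :: "'a data \<Rightarrow> 'a pair_pre_digraph" where
  "Gamma_bar D =
     \<lparr> pverts = (\<Union>i \<in> {1, 2, 3}. pverts (Gam D i)),
       parcs = (\<Union>i \<in> {1, 2, 3}. parcs (Gam D i)) \<union>
               (\<Union>(i, j) \<in> index_pairs. cross_arcs D i j \<union> (cross_arcs D i j)\<inverse>) \<rparr>"

definition constructed_graphs :: "nat \<Rightarrow> nat \<Rightarrow> 'a pair_pre_digraph set" where
  "constructed_graphs l m = {Gamma_bar D | D. construction_data l m D}"

end

theory Submission
  imports Defs
begin

text \<open>
  For \<open>(\<lambda>, \<mu>) = (2, 1)\<close> each of the three graphs would be edge-regular with parameters
  \<open>(8, 4, 2)\<close>, and no such graph exists, by counting triangles. An ordered triangle of an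
  edge-regular graph with parameters \<open>(v, k, \<lambda>)\<close> is an arc, of which there are \<open>v k\<close>
  (\<open>card_parcs_edge_regular\<close>), followed by one of the \<open>\<lambda>\<close> common neighbours of its ends, so
  there are \<open>v k \<lambda>\<close> ordered triangles (\<open>card_ordered_triangles_edge_regular\<close>). Each triangle
  has six orderings, whence 6 divides \<open>v k \<lambda>\<close> (\<open>edge_regular_six_dvd\<close>); but 6 does not
  divide \<open>8 \<cdot> 4 \<cdot> 2 = 64\<close>.
\<close>

text \<open>
  The third vertex is written as a common neighbour of the first two, so that the set is a
  dependent sum over the arcs and its size can be read off.
\<close>

definition ordered_triangles :: "'a pair_pre_digraph \<Rightarrow> (('a \<times> 'a) \<times> 'a) set" where
  "ordered_triangles G = Sigma (parcs G) (\<lambda>(x, y). common_neighbours G x y)"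

lemma card_parcs_edge_regular:
  assumes "edge_regular v k l G"
  shows "card (parcs G) = v * k"
proof -
  interpret pair_graph G
    using assms by (simp add: edge_regular_def regular_graph_def)
  have deg: "card {e \<in> parcs G. fst e = x} = k" if "x \<in> pverts G" for x
    using assms that
    by (simp add: edge_regular_def regular_graph_def out_degree_def out_arcs_def)
  have "card (parcs G) = (\<Sum>x\<in>pverts G. card {e \<in> parcs G. fst e = x})"
    using sum.group[of "parcs G" "pverts G" fst "\<lambda>_. 1::nat"] in_arcsD1 by fastforce
  also have "\<dots> = v * k"
    using assms deg by (simp add: edge_regular_def)
  finally show ?thesis .
qed

lemma card_ordered_triangles_edge_regular:
  assumes "edge_regular v k l G"
  shows "card (ordered_triangles G) = v * k * l"
proof -
  interpret pair_graph G
    using assms by (simp add: edge_regular_def regular_graph_def)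
  have "finite (common_neighbours G x y)" for x y
    by (simp add: common_neighbours_def)
  then have "card (ordered_triangles G) = (\<Sum>(x, y)\<in>parcs G. card (common_neighbours G x y))"
    unfolding ordered_triangles_def
    by (subst card_SigmaI) (auto intro!: sum.cong)
  also have "\<dots> = (\<Sum>e\<in>parcs G. l)"
    using assms by (intro sum.cong) (auto simp: edge_regular_def)
  finally show ?thesis
    using card_parcs_edge_regular[OF assms] by simp
qed

text \<open>
  The ordered triangles on a given vertex set are the six orderings of that set: looplessness
  makes the three vertices distinct, and symmetry makes every ordering a triangle again.
\<close>

lemma six_dvd_card_ordered_triangles:
  assumes "pair_graph G"
  shows "6 dvd card (ordered_triangles G)"
proof -
  interpret pair_graph G by fact
  let ?T = "ordered_triangles G"
  define vs where "vs = (\<lambda>((x, y), z). {x, y, z :: 'a})"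
  have T_iff: "((x, y), z) \<in> ?T \<longleftrightarrow> (x, y) \<in> parcs G \<and> (x, z) \<in> parcs G \<and> (y, z) \<in> parcs G"
    for x y z
    by (auto simp: ordered_triangles_def common_neighbours_def dest: in_arcsD2)
  have sym: "(y, x) \<in> parcs G" if "(x, y) \<in> parcs G" for x y
    using that arcs_symmetric by blast
  have fin: "finite ?T"
    by (auto simp: ordered_triangles_def common_neighbours_def intro!: finite_SigmaI)
  have fibre: "card {t \<in> ?T. vs t = S} = 6" if S: "S \<in> vs ` ?T" for S
  proof -
    obtain x y z where T: "((x, y), z) \<in> ?T" and S_eq: "S = {x, y, z}"
      using S by (auto simp: vs_def)
    have arcs: "(x, y) \<in> parcs G" "(x, z) \<in> parcs G" "(y, z) \<in> parcs G"
      using T by (auto simp: T_iff)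
    have ne: "x \<noteq> y" "x \<noteq> z" "y \<noteq> z"
      using arcs no_loops' by blast+
    have "{t \<in> ?T. vs t = S} =
      {((x, y), z), ((x, z), y), ((y, x), z), ((y, z), x), ((z, x), y), ((z, y), x)}"
      (is "?L = ?R")
    proof
      show "?L \<subseteq> ?R"
      proof
        fix t assume "t \<in> ?L"
        moreover obtain a b c where t: "t = ((a, b), c)"
          by (metis surj_pair)
        ultimately have abc: "{a, b, c} = {x, y, z}"
          by (simp add: vs_def S_eq)
        then have "a \<in> {x, y, z}" "b \<in> {x, y, z}" "c \<in> {x, y, z}"
          "x \<in> {a, b, c}" "y \<in> {a, b, c}" "z \<in> {a, b, c}"
          by blast+
        then show "t \<in> ?R"
          unfolding t using ne by auto
      qed
      show "?R \<subseteq> ?L"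
        using arcs sym by (auto simp: T_iff vs_def S_eq)
    qed
    then show ?thesis
      using ne by simp
  qed
  have "card ?T = (\<Sum>S\<in>vs ` ?T. card {t \<in> ?T. vs t = S})"
    using sum.image_gen[OF fin, of "\<lambda>_. 1::nat" vs] by simp
  also have "\<dots> = card (vs ` ?T) * 6"
    using fibre by simp
  finally show ?thesis
    by simp
qed

corollary edge_regular_six_dvd:
  assumes "edge_regular v k l G"
  shows "6 dvd v * k * l"
  using six_dvd_card_ordered_triangles[of G] card_ordered_triangles_edge_regular[OF assms] assms
  by (simp add: edge_regular_def regular_graph_def)

theorem mainTheorem5:
  shows "(\<nexists>D :: 'a data. construction_data 2 1 D) \<and>
         (constructed_graphs 2 1 :: 'a pair_pre_digraph set) = {}"
proof -
  have "\<not> construction_data 2 1 D" for D :: "'a data"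
  proof
    assume "construction_data 2 1 D"
    then have "edge_regular 8 4 2 (Gam D 1)"
      by (simp add: construction_data_def Let_def)
    from edge_regular_six_dvd[OF this] show False
      by simp
  qed
  then show ?thesis
    by (simp add: constructed_graphs_def)
qed

end
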